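(* (RDR graph stitching) Let $X_1,X_2$ be two $d$-RDR graphs and let $f_1,f_2$ be their $d$-RDR coloring functions. Suppose that $e_1=\{u_1,v_1\}\in E(X_1)$ and $e_2=\{u_2,v_2\}\in E(X_2)$ are two edges with endpoints of same color: $f_1(u_1)=f_2(u_2)\ne\emptyset$ (implying $f_1(v_1)=f_2(v_2)=\emptyset$). Let $X_1*X_2$ be the graph with vertex set $V(X_1*X_2)=V(X_1)\cup V(X_2)$ and edge set $E(X_1*X_2)=(E(X_1)\cup E(X_2)\cup\{e_1',e_2'\})\setminus\{e_1,e_2\}$, where $e_1'=\{u_1,v_2\}$ and $e_2'=\{u_2,v_1\}$. Then $X_1*X_2$ is a $d$-RDR graph with $d$-RDR coloring function $f=f_1\cup f_2$. Moreover, a similar operation can be defined with several pairs of edges with endpoints of same color in each pair.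
   Context: All graphs are finite and simple, and $d$ is a positive integer. For a graph $G=(V,E)$, $N(v)$ is the open neighbourhood of $v$. Let $\mathcal K=\{1,\dots,k\}$. A $k$-rainbow dominating function ($k$-RDF) on $G$ is a map $f\colon V\to 2^{\mathcal K}$ such that $f(v)=\emptyset$ implies $\bigcup_{u\in N(v)}f(u)=\mathcal K$, for all $v\in V$. Its weight is $w(f)=\sum_{v\in V}|f(v)|$, and the $k$-rainbow domination number $\gamma_{rk}(G)$ is the minimum weight of a $k$-RDF on $G$. It is known that a $d$-regular graph $G$ of order $n$ satisfies $\gamma_{rd}(G)\ge n/2$. A $d$-regular graph $G$ of order $n$ is called $d$-rainbow domination regular ($d$-RDR) if $\gamma_{rd}(G)=n/2$. A $d$-RDR coloring function on a $d$-RDR graph is a $d$-RDF of minimum weight $n/2$. It is known that for such a function the sets of colored vertices ($f(v)\ne\emptyset$) and non-colored vertices ($f(v)=\emptyset$) form a bipartition of the graph into sets of size $n/2$, and each colored vertex receives exactly one color. The vertex sets of $X_1$ and $X_2$ are understood to be disjoint, and $f_1\cup f_2$ denotes the function on $V(X_1)\cup V(X_2)$ equal to $f_i$ on $V(X_i)$ for $i=1,2$. *)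

theory Defs
  imports Complex_Main
begin

record 'a graph =
  verts :: "'a set"
  edges :: "'a set set"

definition finite_simple_graph :: "'a graph \<Rightarrow> bool" where
  "finite_simple_graph G \<longleftrightarrow>
     finite (verts G) \<and> (\<forall>e\<in>edges G. e \<subseteq> verts G \<and> card e = 2)"

definition neighbourhood :: "'a graph \<Rightarrow> 'a \<Rightarrow> 'a set" where
  "neighbourhood G v = {u. {v, u} \<in> edges G}"

definition regular_graph :: "nat \<Rightarrow> 'a graph \<Rightarrow> bool" where
  "regular_graph d G \<longleftrightarrow>
     finite_simple_graph G \<and> (\<forall>v\<in>verts G. card (neighbourhood G v) = d)"

text \<open>Values of a labelling outside the vertex set are irrelevant throughout.\<close>

definition rdf :: "nat \<Rightarrow> 'a graph \<Rightarrow> ('a \<Rightarrow> nat set) \<Rightarrow> bool" where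
  "rdf k G f \<longleftrightarrow>
     (\<forall>v\<in>verts G. f v \<subseteq> {1..k}) \<and>
     (\<forall>v\<in>verts G. f v = {} \<longrightarrow> (\<Union>u\<in>neighbourhood G v. f u) = {1..k})"

definition weight :: "'a graph \<Rightarrow> ('a \<Rightarrow> nat set) \<Rightarrow> nat" where
  "weight G f = (\<Sum>v\<in>verts G. card (f v))"

text \<open>The minimum exists, since the constant function with value \<open>{1..k}\<close> is a k-RDF.\<close>

definition rainbow_domination_number :: "nat \<Rightarrow> 'a graph \<Rightarrow> nat" where
  "rainbow_domination_number k G = (LEAST w. \<exists>f. rdf k G f \<and> weight G f = w)"

definition rdr_graph :: "nat \<Rightarrow> 'a graph \<Rightarrow> bool" where
  "rdr_graph d G \<longleftrightarrow>
     regular_graph d G \<and>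
     real (rainbow_domination_number d G) = real (card (verts G)) / 2"

definition rdr_coloring :: "nat \<Rightarrow> 'a graph \<Rightarrow> ('a \<Rightarrow> nat set) \<Rightarrow> bool" where
  "rdr_coloring d G f \<longleftrightarrow>
     rdf d G f \<and> real (weight G f) = real (card (verts G)) / 2"

text \<open>The function \<open>f\<^sub>1 \<union> f\<^sub>2\<close> on the union of two disjoint vertex sets.\<close>

definition union_coloring ::
  "'a graph \<Rightarrow> ('a \<Rightarrow> nat set) \<Rightarrow> ('a \<Rightarrow> nat set) \<Rightarrow> 'a \<Rightarrow> nat set" where
  "union_coloring X1 f1 f2 = (\<lambda>v. if v \<in> verts X1 then f1 v else f2 v)"

definition stitch ::
  "'a graph \<Rightarrow> 'a graph \<Rightarrow> 'a \<Rightarrow> 'a \<Rightarrow> 'a \<Rightarrow> 'a \<Rightarrow> 'a graph" where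
  "stitch X1 X2 u1 v1 u2 v2 =
     \<lparr> verts = verts X1 \<union> verts X2,
       edges = (edges X1 \<union> edges X2 \<union> {{u1, v2}, {u2, v1}}) - {{u1, v1}, {u2, v2}} \<rparr>"

text \<open>Simultaneous stitching along the pairs of edges \<open>{u1 i, v1 i}\<close>, \<open>{u2 i, v2 i}\<close>
  for \<open>i < m\<close>.\<close>

definition multi_stitch ::
  "'a graph \<Rightarrow> 'a graph \<Rightarrow> nat \<Rightarrow> (nat \<Rightarrow> 'a) \<Rightarrow> (nat \<Rightarrow> 'a) \<Rightarrow> (nat \<Rightarrow> 'a) \<Rightarrow> (nat \<Rightarrow> 'a)
    \<Rightarrow> 'a graph" where
  "multi_stitch X1 X2 m u1 v1 u2 v2 =
     \<lparr> verts = verts X1 \<union> verts X2,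
       edges = (edges X1 \<union> edges X2 \<union> (\<Union>i<m. {{u1 i, v2 i}, {u2 i, v1 i}}))
               - (\<Union>i<m. {{u1 i, v1 i}, {u2 i, v2 i}}) \<rparr>"

text \<open>The chosen edges must be distinct in each graph, and the new edges
  \<open>{u1 i, v2 i}\<close>, and likewise \<open>{u2 i, v1 i}\<close>, must be distinct for different \<open>i\<close>: otherwise
  parallel edges would be created (or, in a simple graph, degrees would change). Edges sharing
  endpoints are otherwise allowed.\<close>

definition stitchable_pairs ::
  "'a graph \<Rightarrow> 'a graph \<Rightarrow> ('a \<Rightarrow> nat set) \<Rightarrow> ('a \<Rightarrow> nat set) \<Rightarrow>
    nat \<Rightarrow> (nat \<Rightarrow> 'a) \<Rightarrow> (nat \<Rightarrow> 'a) \<Rightarrow> (nat \<Rightarrow> 'a) \<Rightarrow> (nat \<Rightarrow> 'a) \<Rightarrow> bool" where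
  "stitchable_pairs X1 X2 f1 f2 m u1 v1 u2 v2 \<longleftrightarrow>
     (\<forall>i<m. {u1 i, v1 i} \<in> edges X1 \<and> {u2 i, v2 i} \<in> edges X2 \<and>
            f1 (u1 i) = f2 (u2 i) \<and> f1 (u1 i) \<noteq> {}) \<and>
     inj_on (\<lambda>i. {u1 i, v1 i}) {..<m} \<and> inj_on (\<lambda>i. {u2 i, v2 i}) {..<m} \<and>
     inj_on (\<lambda>i. {u1 i, v2 i}) {..<m} \<and> inj_on (\<lambda>i. {u2 i, v1 i}) {..<m}"

end

theory Submission
  imports Defs
begin

text \<open>
  For a \<open>d\<close>-RDF \<open>f\<close> on a \<open>d\<close>-regular graph, every vertex \<open>v\<close> has
  local weight \<open>d |f(v)| + \<Sum>u\<in>N(v). |f(u)|\<close> at least \<open>d\<close>, and the local weights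
  sum up to \<open>2 d w(f)\<close>. This gives \<open>w(f) \<ge> n/2\<close>, and in the case of equality all local
  weights are equal to \<open>d\<close>, so that the coloured vertices carry one colour each and every edge
  joins a coloured to an uncoloured vertex. Stitching therefore replaces, at each endpoint,
  a neighbour by a new one with the same label: degrees and the domination property are
  preserved, and the weight of the union is again half of the order.
\<close>

section \<open>Neighbourhoods in simple graphs\<close>

lemma neighbourhood_sym: "u \<in> neighbourhood G v \<longleftrightarrow> v \<in> neighbourhood G u"
  by (simp add: neighbourhood_def insert_commute)

lemma neighbourhood_subset_verts: "finite_simple_graph G \<Longrightarrow> neighbourhood G v \<subseteq> verts G"
  by (auto simp: finite_simple_graph_def neighbourhood_def)

lemma finite_neighbourhood: "finite_simple_graph G \<Longrightarrow> finite (neighbourhood G v)"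
  by (meson finite_simple_graph_def finite_subset neighbourhood_subset_verts)

text \<open>This is the degree count of stitching: \<open>I\<close> indexes both the lost neighbours
  \<open>p\<close> I\<open>and the new ones\<close>q \<open>I\<close>, and injectivity of both maps
  makes loss and gain equal.\<close>

lemma card_replace:
  assumes "finite A" "p ` I \<subseteq> A" "A \<inter> q ` I = {}" "inj_on p I" "inj_on q I" "finite I"
  shows "card ((A - p ` I) \<union> q ` I) = card A"
proof -
  have "card ((A - p ` I) \<union> q ` I) = card (A - p ` I) + card (q ` I)"
    using assms by (intro card_Un_disjoint) auto
  also have "\<dots> = card A - card I + card I"
    using assms by (simp add: card_Diff_subset card_image)
  also have "\<dots> = card A"
    using card_mono[OF assms(1,2)] assms(4) by (simp add: card_image)
  finally show ?thesis .
qed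

section \<open>Local weights and the lower bound on the weight\<close>

definition local_weight :: "nat \<Rightarrow> 'a graph \<Rightarrow> ('a \<Rightarrow> nat set) \<Rightarrow> 'a \<Rightarrow> nat" where
  "local_weight d G f v = d * card (f v) + (\<Sum>u\<in>neighbourhood G v. card (f u))"

text \<open>Double counting: each vertex contributes its label size \<open>d\<close> times at itself
  and once at each of its \<open>d\<close> neighbours.\<close>

lemma sum_local_weight:
  assumes "regular_graph d G"
  shows "(\<Sum>v\<in>verts G. local_weight d G f v) = 2 * d * weight G f"
proof -
  have fsg: "finite_simple_graph G" and fin: "finite (verts G)"
    using assms by (auto simp: regular_graph_def finite_simple_graph_def)
  \<comment> \<open>Neighbourhoods are written as filtered subsets of \<open>verts G\<close>, in
    both directions, so that the two summations can be interchanged.\<close>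
  have nb: "{u \<in> verts G. u \<in> neighbourhood G v} = neighbourhood G v"
    "{u \<in> verts G. v \<in> neighbourhood G u} = neighbourhood G v" for v
    using neighbourhood_subset_verts[OF fsg] neighbourhood_sym[of v G] by auto
  have "(\<Sum>v\<in>verts G. \<Sum>u\<in>neighbourhood G v. card (f u))
      = (\<Sum>v\<in>verts G. \<Sum>u | u \<in> verts G \<and> u \<in> neighbourhood G v. card (f u))"
    by (simp add: nb)
  also have "\<dots> = (\<Sum>u\<in>verts G. \<Sum>v | v \<in> verts G \<and> u \<in> neighbourhood G v. card (f u))"
    by (rule sum.swap_restrict[OF fin fin])
  also have "\<dots> = (\<Sum>u\<in>verts G. card (neighbourhood G u) * card (f u))"
    by (simp add: nb)
  also have "\<dots> = d * weight G f"
    using assms by (simp add: regular_graph_def weight_def sum_distrib_left)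
  finally show ?thesis
    by (simp add: local_weight_def sum.distrib weight_def flip: sum_distrib_left)
qed

text \<open>At an empty vertex the labels of the neighbours must cover \<open>{1..d}\<close>; at any
  other vertex the first summand alone is at least \<open>d\<close>.\<close>

lemma local_weight_ge:
  assumes "regular_graph d G" "rdf d G f" "v \<in> verts G"
  shows "d \<le> local_weight d G f v"
proof (cases "f v = {}")
  case True
  then have "d = card (\<Union>u\<in>neighbourhood G v. f u)"
    using assms by (simp add: rdf_def)
  also have "\<dots> \<le> (\<Sum>u\<in>neighbourhood G v. card (f u))"
    using assms by (intro card_UN_le finite_neighbourhood) (simp add: regular_graph_def)
  finally show ?thesis
    by (simp add: local_weight_def)
next
  case False
  then have "card (f v) \<ge> 1"
    using assms by (metis One_nat_def Suc_leI card_gt_0_iff finite_atLeastAtMost finite_subset rdf_def)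
  then have "d \<le> d * card (f v)"
    by simp
  then show ?thesis
    unfolding local_weight_def by (rule trans_le_add1)
qed

lemma rdf_weight_ge:
  assumes "d > 0" "regular_graph d G" "rdf d G f"
  shows "card (verts G) \<le> 2 * weight G f"
proof -
  have "d * card (verts G) \<le> (\<Sum>v\<in>verts G. local_weight d G f v)"
    using sum_mono[of "verts G" "\<lambda>_. d", OF local_weight_ge[OF assms(2,3)]]
    by (simp add: mult.commute)
  then have "d * card (verts G) \<le> d * (2 * weight G f)"
    by (simp add: sum_local_weight[OF assms(2)] mult_ac)
  then show ?thesis
    using assms(1) by simp
qed

section \<open>Colorings that attain the bound\<close>

lemma rdr_graph_if_coloring:
  assumes "d > 0" "regular_graph d G" "rdr_coloring d G f"
  shows "rdr_graph d G"
proof -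
  \<comment> \<open>By \<open>rdf_weight_ge\<close> every \<open>d\<close>-RDF weighs at least half
    of the order, and \<open>f\<close> weighs exactly that, so the minimum is attained at
    \<open>f\<close>.\<close>
  have "(LEAST w. \<exists>f. rdf d G f \<and> weight G f = w) = weight G f"
  proof (rule Least_equality)
    show "\<exists>g. rdf d G g \<and> weight G g = weight G f"
      using assms by (auto simp: rdr_coloring_def)
    show "weight G f \<le> w" if ex: "\<exists>g. rdf d G g \<and> weight G g = w" for w
    proof -
      obtain g where "rdf d G g" "weight G g = w"
        using ex by blast
      with rdf_weight_ge[OF assms(1,2)] have "card (verts G) \<le> 2 * w"
        by blast
      moreover have "2 * weight G f = card (verts G)"
        using assms(3) by (simp add: rdr_coloring_def field_simps flip: of_nat_mult)
      ultimately show ?thesis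
        by linarith
    qed
  qed
  then show ?thesis
    using assms by (simp add: rdr_graph_def rdr_coloring_def rainbow_domination_number_def)
qed

text \<open>Both sides have the same total over \<open>verts G\<close>, so the termwise inequality
  \<open>local_weight_ge\<close> cannot be strict anywhere.\<close>

lemma rdr_coloring_local_weight:
  assumes "regular_graph d G" "rdr_coloring d G f" "v \<in> verts G"
  shows "local_weight d G f v = d"
proof -
  have fin: "finite (verts G)" and rdf: "rdf d G f"
    using assms by (auto simp: regular_graph_def finite_simple_graph_def rdr_coloring_def)
  have "2 * weight G f = card (verts G)"
    using assms(2) by (simp add: rdr_coloring_def field_simps flip: of_nat_mult)
  then have "(\<Sum>v\<in>verts G. d) = (\<Sum>v\<in>verts G. local_weight d G f v)"
    by (simp add: sum_local_weight[OF assms(1)])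
  then show ?thesis
    by (rule sum_mono_inv[symmetric]) (use local_weight_ge[OF assms(1) rdf] assms(3) fin in auto)
qed

text \<open>A nonempty label at \<open>u\<close> already uses up the whole local weight
  \<open>d\<close> there, which leaves nothing for the neighbours of \<open>u\<close>.\<close>

lemma rdr_coloring_neighbour_empty:
  assumes "d > 0" "regular_graph d G" "rdr_coloring d G f" "{u, v} \<in> edges G" "f u \<noteq> {}"
  shows "f v = {}"
proof -
  have fsg: "finite_simple_graph G" and rdf: "rdf d G f"
    using assms by (auto simp: regular_graph_def rdr_coloring_def)
  have uv: "u \<in> verts G" "v \<in> verts G" "v \<in> neighbourhood G u"
    using fsg assms(4) by (auto simp: finite_simple_graph_def neighbourhood_def)
  have fin: "finite (f x)" if "x \<in> verts G" for x
    using rdf that by (meson finite_atLeastAtMost finite_subset rdf_def)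
  have "card (f u) \<ge> 1"
    using fin[OF uv(1)] assms(5) by (simp add: Suc_le_eq card_gt_0_iff)
  then have "d \<le> d * card (f u)"
    by simp
  then have "(\<Sum>x\<in>neighbourhood G u. card (f x)) = 0"
    using rdr_coloring_local_weight[OF assms(2,3) uv(1)] unfolding local_weight_def by linarith
  then have "card (f v) = 0"
    using uv(3) finite_neighbourhood[OF fsg] by (meson sum_eq_0_iff)
  then show ?thesis
    using fin[OF uv(2)] by simp
qed

section \<open>Stitching along several pairs of edges\<close>

lemma multi_stitch_commute:
  "multi_stitch X1 X2 m u1 v1 u2 v2 = multi_stitch X2 X1 m u2 v2 u1 v1"
  by (simp add: multi_stitch_def Un_commute insert_commute)

locale stitching =
  fixes d :: nat and X1 X2 :: "'a graph" and f1 f2 :: "'a \<Rightarrow> nat set"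
    and m :: nat and u1 v1 u2 v2 :: "nat \<Rightarrow> 'a"
  assumes d_pos: "d > 0"
    and regular: "regular_graph d X1" "regular_graph d X2"
    and coloring: "rdr_coloring d X1 f1" "rdr_coloring d X2 f2"
    and disjoint: "verts X1 \<inter> verts X2 = {}"
    and pairs: "stitchable_pairs X1 X2 f1 f2 m u1 v1 u2 v2"
begin

abbreviation "X \<equiv> multi_stitch X1 X2 m u1 v1 u2 v2"

abbreviation "f \<equiv> union_coloring X1 f1 f2"

lemma simple: "finite_simple_graph X1" "finite_simple_graph X2"
  using regular by (auto simp: regular_graph_def)

lemma verts_X: "verts X = verts X1 \<union> verts X2"
  by (simp add: multi_stitch_def)

lemma pair_edge:
  assumes "i < m"
  shows "{u1 i, v1 i} \<in> edges X1" "{u2 i, v2 i} \<in> edges X2"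
    "f1 (u1 i) = f2 (u2 i)" "f1 (u1 i) \<noteq> {}"
  using pairs assms by (auto simp: stitchable_pairs_def)

lemma pair_verts:
  assumes "i < m"
  shows "u1 i \<in> verts X1" "v1 i \<in> verts X1" "u2 i \<in> verts X2" "v2 i \<in> verts X2"
  using pair_edge(1,2)[OF assms] simple by (auto simp: finite_simple_graph_def)

lemma pair_uncoloured: "i < m \<Longrightarrow> f1 (v1 i) = {}"
  using rdr_coloring_neighbour_empty[OF d_pos regular(1) coloring(1)] pair_edge by blast

lemma f_eq: "x \<in> verts X1 \<Longrightarrow> f x = f1 x" "x \<in> verts X2 \<Longrightarrow> f x = f2 x"
  using disjoint by (auto simp: union_coloring_def)

text \<open>The situation is symmetric in the two graphs. Facts are therefore proved at vertices of
  \<open>X1\<close> only and carried over to \<open>X2\<close> by this lemma and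
  \<open>multi_stitch_commute\<close>.\<close>

lemma swapped: "stitching d X2 X1 f2 f1 m u2 v2 u1 v1"
proof
  show "stitchable_pairs X2 X1 f2 f1 m u2 v2 u1 v1"
    using pairs by (auto simp: stitchable_pairs_def)
qed (use d_pos regular coloring disjoint in auto)

text \<open>A vertex may lie on several chosen edges, hence the index sets: for each
  \<open>i\<close> with \<open>u1 i = x\<close> the neighbour \<open>v1 i\<close> gives way to
  \<open>v2 i\<close>, and for each \<open>i\<close> with \<open>v1 i = x\<close> the neighbour
  \<open>u1 i\<close> gives way to \<open>u2 i\<close>.\<close>

lemma neighbourhood_stitch:
  assumes "x \<in> verts X1"
  shows "neighbourhood X x =
    (neighbourhood X1 x - (v1 ` {i. i < m \<and> u1 i = x} \<union> u1 ` {i. i < m \<and> v1 i = x})) \<union>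
    (v2 ` {i. i < m \<and> u1 i = x} \<union> u2 ` {i. i < m \<and> v1 i = x})" (is "_ = ?R")
proof (rule set_eqI)
  fix y
  have X2: "{x, y} \<notin> edges X2"
    using assms simple(2) disjoint unfolding finite_simple_graph_def by blast
  \<comment> \<open>As \<open>x\<close> lies in \<open>X1\<close>, disjointness fixes which end of a
    new edge is \<open>x\<close> and rules out the deleted edges of \<open>X2\<close>.\<close>
  have new: "i < m \<Longrightarrow> {x, y} = {u1 i, v2 i} \<longleftrightarrow> x = u1 i \<and> y = v2 i"
    "i < m \<Longrightarrow> {x, y} = {u2 i, v1 i} \<longleftrightarrow> x = v1 i \<and> y = u2 i"
    "i < m \<Longrightarrow> {x, y} \<noteq> {u2 i, v2 i}" for i
    using pair_verts[of i] assms disjoint by (auto simp: doubleton_eq_iff)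
  have "y \<in> neighbourhood X x \<longleftrightarrow>
      ({x, y} \<in> edges X1 \<or> (\<exists>i<m. {x, y} = {u1 i, v2 i} \<or> {x, y} = {u2 i, v1 i}))
      \<and> (\<forall>i<m. {x, y} \<noteq> {u1 i, v1 i} \<and> {x, y} \<noteq> {u2 i, v2 i})"
    using X2 by (auto simp: neighbourhood_def multi_stitch_def)
  also have "\<dots> \<longleftrightarrow>
      ({x, y} \<in> edges X1 \<or> (\<exists>i<m. x = u1 i \<and> y = v2 i \<or> x = v1 i \<and> y = u2 i))
      \<and> (\<forall>i<m. {x, y} \<noteq> {u1 i, v1 i})"
    by (simp only: new simp_thms cong: conj_cong imp_cong)
  also have "\<dots> \<longleftrightarrow>
      ({x, y} \<in> edges X1 \<and> (\<forall>i<m. {x, y} \<noteq> {u1 i, v1 i}))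
      \<or> (\<exists>i<m. x = u1 i \<and> y = v2 i \<or> x = v1 i \<and> y = u2 i)"
  proof -
    \<comment> \<open>New edges cross between the two graphs, so the deletion never hits one of
      them.\<close>
    have "{x, y} \<noteq> {u1 j, v1 j}"
      if "i < m" "x = u1 i \<and> y = v2 i \<or> x = v1 i \<and> y = u2 i" "j < m" for i j
      using that pair_verts[of i] pair_verts[of j] disjoint by (auto simp: doubleton_eq_iff)
    then show ?thesis
      by blast
  qed
  also have "\<dots> \<longleftrightarrow> y \<in> ?R"
    by (simp add: neighbourhood_def doubleton_eq_iff image_iff) blast
  finally show "y \<in> neighbourhood X x \<longleftrightarrow> y \<in> ?R" .
qed

text \<open>The label of \<open>x\<close> decides its role: an empty vertex is never some
  \<open>u1 i\<close>, a nonempty one never some \<open>v1 i\<close>. So only one of the two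
  replacements takes place, and \<open>card_replace\<close> applies to it.\<close>

lemma card_neighbourhood_stitch:
  assumes x: "x \<in> verts X1"
  shows "card (neighbourhood X x) = d"
proof -
  let ?U = "{i. i < m \<and> u1 i = x}" and ?V = "{i. i < m \<and> v1 i = x}"
  have fin: "finite (neighbourhood X1 x)"
    using simple(1) by (rule finite_neighbourhood)
  have sub: "neighbourhood X1 x \<subseteq> verts X1"
    using simple(1) by (rule neighbourhood_subset_verts)
  have inj: "inj_on (\<lambda>i. {u1 i, v1 i}) {..<m}" "inj_on (\<lambda>i. {u1 i, v2 i}) {..<m}"
    "inj_on (\<lambda>i. {u2 i, v1 i}) {..<m}"
    using pairs by (auto simp: stitchable_pairs_def)
  have "card (neighbourhood X x) = card (neighbourhood X1 x)"
  proof (cases "f1 x = {}")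
    case True
    then have "?U = {}"
      using pair_edge(4) by auto
    then have "neighbourhood X x = (neighbourhood X1 x - u1 ` ?V) \<union> u2 ` ?V"
      unfolding neighbourhood_stitch[OF x] by (simp only: image_empty Un_empty_left Un_empty_right)
    moreover have "u1 ` ?V \<subseteq> neighbourhood X1 x"
      using pair_edge(1) by (auto simp: neighbourhood_def insert_commute)
    moreover have "neighbourhood X1 x \<inter> u2 ` ?V = {}"
      using pair_verts(3) sub disjoint by blast
    \<comment> \<open>The edges indexed by \<open>?V\<close> share the endpoint \<open>x\<close>, so
      distinct edges have distinct other endpoints.\<close>
    moreover have "inj_on u1 ?V" "inj_on u2 ?V"
      using inj(1,3) by (auto simp: inj_on_def)
    ultimately show ?thesis
      using fin by (simp add: card_replace)
  next
    case False
    then have "?V = {}"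
      using pair_uncoloured by auto
    then have "neighbourhood X x = (neighbourhood X1 x - v1 ` ?U) \<union> v2 ` ?U"
      unfolding neighbourhood_stitch[OF x] by (simp only: image_empty Un_empty_left Un_empty_right)
    moreover have "v1 ` ?U \<subseteq> neighbourhood X1 x"
      using pair_edge(1) by (auto simp: neighbourhood_def)
    moreover have "neighbourhood X1 x \<inter> v2 ` ?U = {}"
      using pair_verts(4) sub disjoint by blast
    moreover have "inj_on v1 ?U" "inj_on v2 ?U"
      using inj(1,2) by (auto simp: inj_on_def)
    ultimately show ?thesis
      using fin by (simp add: card_replace)
  qed
  then show ?thesis
    using regular(1) x by (simp add: regular_graph_def)
qed

text \<open>A color seen at a lost neighbour \<open>u1 i\<close> is seen again at its substitute
  \<open>u2 i\<close>, which has the same label.\<close>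

lemma dominated_stitch:
  assumes x: "x \<in> verts X1" and empty: "f1 x = {}"
  shows "{1..d} \<subseteq> (\<Union>y\<in>neighbourhood X x. f y)"
proof
  fix c assume "c \<in> {1..d}"
  then obtain y where y: "y \<in> neighbourhood X1 x" "c \<in> f1 y"
    using coloring(1) x empty unfolding rdr_coloring_def rdf_def by blast
  have y1: "y \<in> verts X1"
    using y(1) neighbourhood_subset_verts[OF simple(1)] by blast
  show "c \<in> (\<Union>y\<in>neighbourhood X x. f y)"
  proof (cases "\<exists>i<m. v1 i = x \<and> u1 i = y")
    case True
    then obtain i where i: "i < m" "v1 i = x" "u1 i = y"
      by blast
    then have "u2 i \<in> neighbourhood X x"
      using neighbourhood_stitch[OF x] by blast
    moreover have "c \<in> f (u2 i)"
      using i y(2) pair_edge(3)[of i] pair_verts(3)[of i] f_eq(2) by auto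
    ultimately show ?thesis
      by blast
  next
    case False
    \<comment> \<open>Being empty, \<open>x\<close> is no \<open>u1 i\<close>, so \<open>y\<close>
      could only be lost as some \<open>u1 i\<close> with \<open>v1 i = x\<close>, which this case
      excludes.\<close>
    then have "y \<in> neighbourhood X x"
      using neighbourhood_stitch[OF x] y(1) pair_edge(4) empty by auto
    then show ?thesis
      using y(2) y1 f_eq(1) by auto
  qed
qed

lemma simple_stitch: "finite_simple_graph X"
proof -
  have "e \<subseteq> verts X \<and> card e = 2" if "e \<in> edges X" for e
  proof -
    have "e \<in> edges X1 \<or> e \<in> edges X2 \<or> (\<exists>i<m. e = {u1 i, v2 i} \<or> e = {u2 i, v1 i})"
      using that by (auto simp: multi_stitch_def)
    \<comment> \<open>The ends of a new edge lie in disjoint vertex sets, so no loop arises.\<close>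
    moreover have "u1 i \<noteq> v2 i \<and> u2 i \<noteq> v1 i" if "i < m" for i
      using pair_verts[OF that] disjoint by auto
    ultimately show ?thesis
      using simple pair_verts unfolding verts_X finite_simple_graph_def
      by (auto simp: card_2_iff)
  qed
  then show ?thesis
    using simple by (simp add: finite_simple_graph_def verts_X)
qed

lemma regular_stitch: "regular_graph d X"
  using simple_stitch card_neighbourhood_stitch stitching.card_neighbourhood_stitch[OF swapped]
  by (auto simp: regular_graph_def verts_X multi_stitch_commute[of X2])

lemma rdf_stitch: "rdf d X f"
proof -
  have f_sub: "f x \<subseteq> {1..d}" if "x \<in> verts X" for x
  proof -
    have "\<forall>v\<in>verts X1. f1 v \<subseteq> {1..d}" "\<forall>v\<in>verts X2. f2 v \<subseteq> {1..d}"
      using coloring unfolding rdr_coloring_def rdf_def by blast+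
    then show ?thesis
      using that f_eq by (metis Un_iff verts_X)
  qed
  have nb_sub: "neighbourhood X x \<subseteq> verts X" for x
    using simple_stitch by (rule neighbourhood_subset_verts)
  \<comment> \<open>\<open>union_coloring\<close> tests membership in its first graph, so swapping
    the graphs gives a function known to agree with \<open>f\<close> only on
    \<open>verts X\<close>.\<close>
  have f_commute: "f y = union_coloring X2 f2 f1 y" if "y \<in> verts X" for y
    using that f_eq stitching.f_eq[OF swapped] by (auto simp: verts_X)
  have "{1..d} \<subseteq> (\<Union>y\<in>neighbourhood X x. f y)" if x: "x \<in> verts X" and "f x = {}" for x
  proof (cases "x \<in> verts X1")
    case True
    then show ?thesis
      using dominated_stitch that f_eq by simp
  next
    case False
    then have "x \<in> verts X2" "f2 x = {}"
      using x \<open>f x = {}\<close> f_eq(2) by (auto simp: verts_X)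
    then have "{1..d} \<subseteq> (\<Union>y\<in>neighbourhood X x. union_coloring X2 f2 f1 y)"
      using stitching.dominated_stitch[OF swapped] by (simp add: multi_stitch_commute[of X2])
    also have "\<dots> = (\<Union>y\<in>neighbourhood X x. f y)"
      using f_commute nb_sub by (intro SUP_cong) auto
    finally show ?thesis .
  qed
  moreover have "(\<Union>y\<in>neighbourhood X x. f y) \<subseteq> {1..d}" for x
    using f_sub nb_sub by blast
  ultimately show ?thesis
    using f_sub by (simp add: rdf_def subset_antisym)
qed

text \<open>Weight and order are both additive over the disjoint union, so the ratio one half
  persists.\<close>

lemma rdr_coloring_stitch: "rdr_coloring d X f"
proof -
  have fin: "finite (verts X1)" "finite (verts X2)"
    using simple by (auto simp: finite_simple_graph_def)
  have "weight X f = weight X1 f1 + weight X2 f2"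
    using fin disjoint f_eq by (simp add: weight_def verts_X sum.union_disjoint)
  moreover have "card (verts X) = card (verts X1) + card (verts X2)"
    using fin disjoint by (simp add: verts_X card_Un_disjoint)
  ultimately show ?thesis
    using rdf_stitch coloring by (simp add: rdr_coloring_def add_divide_distrib)
qed

lemma rdr_stitch:
  "(\<forall>i<m. f1 (v1 i) = {} \<and> f2 (v2 i) = {}) \<and> rdr_graph d X \<and> rdr_coloring d X f"
  using pair_uncoloured stitching.pair_uncoloured[OF swapped] rdr_coloring_stitch
    rdr_graph_if_coloring[OF d_pos regular_stitch] by blast

end

section \<open>A single pair as the case of one index, and the theorem\<close>

lemma stitch_eq_multi_stitch:
  "stitch X1 X2 u1 v1 u2 v2 = multi_stitch X1 X2 1 (\<lambda>_. u1) (\<lambda>_. v1) (\<lambda>_. u2) (\<lambda>_. v2)"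
  by (auto simp: stitch_def multi_stitch_def)

theorem proposition2p6:
  fixes X1 X2 :: "'a graph"
    and f1 f2 :: "'a \<Rightarrow> nat set"
    and d :: nat
  assumes "d > 0"
    and "rdr_graph d X1" and "rdr_graph d X2"
    and "rdr_coloring d X1 f1" and "rdr_coloring d X2 f2"
    and "verts X1 \<inter> verts X2 = {}"
  shows "(\<forall>u1 v1 u2 v2.
            {u1, v1} \<in> edges X1 \<and> {u2, v2} \<in> edges X2 \<and>
            f1 u1 = f2 u2 \<and> f1 u1 \<noteq> {} \<longrightarrow>
              f1 v1 = {} \<and> f2 v2 = {} \<and>
              rdr_graph d (stitch X1 X2 u1 v1 u2 v2) \<and>
              rdr_coloring d (stitch X1 X2 u1 v1 u2 v2) (union_coloring X1 f1 f2)) \<and>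
         (\<forall>m u1 v1 u2 v2.
            stitchable_pairs X1 X2 f1 f2 m u1 v1 u2 v2 \<longrightarrow>
              (\<forall>i<m. f1 (v1 i) = {} \<and> f2 (v2 i) = {}) \<and>
              rdr_graph d (multi_stitch X1 X2 m u1 v1 u2 v2) \<and>
              rdr_coloring d (multi_stitch X1 X2 m u1 v1 u2 v2) (union_coloring X1 f1 f2))"
proof -
  have multi: "(\<forall>i<m. f1 (v1 i) = {} \<and> f2 (v2 i) = {}) \<and>
      rdr_graph d (multi_stitch X1 X2 m u1 v1 u2 v2) \<and>
      rdr_coloring d (multi_stitch X1 X2 m u1 v1 u2 v2) (union_coloring X1 f1 f2)"
    if "stitchable_pairs X1 X2 f1 f2 m u1 v1 u2 v2" for m u1 v1 u2 v2
    by (rule stitching.rdr_stitch, unfold_locales)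
      (use assms that in \<open>auto simp: rdr_graph_def\<close>)
  moreover have "f1 v1 = {} \<and> f2 v2 = {} \<and> rdr_graph d (stitch X1 X2 u1 v1 u2 v2) \<and>
      rdr_coloring d (stitch X1 X2 u1 v1 u2 v2) (union_coloring X1 f1 f2)"
    if "{u1, v1} \<in> edges X1 \<and> {u2, v2} \<in> edges X2 \<and> f1 u1 = f2 u2 \<and> f1 u1 \<noteq> {}"
    for u1 v1 u2 v2
  proof -
    \<comment> \<open>With the single index \<open>0\<close> the injectivity conditions hold
      trivially for constant families.\<close>
    have "stitchable_pairs X1 X2 f1 f2 1 (\<lambda>_. u1) (\<lambda>_. v1) (\<lambda>_. u2) (\<lambda>_. v2)"
      using that by (auto simp: stitchable_pairs_def inj_on_def)
    from multi[OF this] show ?thesis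
      by (simp add: stitch_eq_multi_stitch)
  qed
  ultimately show ?thesis
    by blast
qed

end
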